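(* Let $1\le p<\infty$, and let $u:\mathbb{N}\to\mathbb{C}$ and $\phi:\mathbb{N}\to\mathbb{N}$ be such that $uC_\phi$ is a bounded linear operator on $\ell_p$. Suppose that $S(u)$ is invariant under $\phi$. Then, for each $n\ge 1$, $$\dim\left(N((uC_\phi)^n)\right)=|\mathbb{N}-\phi_n(S(u))|.$$
   Context: $\mathbb{N}$ is the set of positive integers; $\ell_p$ is the Banach space of $p$-summable complex sequences, viewed as functions on $\mathbb{N}$. The operator $uC_\phi$ is defined by $uC_\phi(f)=u\cdot(f\circ\phi)$, i.e. $(uC_\phi f)(m)=u(m)f(\phi(m))$. $N(T)$ is the null space of $T$; $S(u)=\{n\in\mathbb{N}: u(n)\ne 0\}$; $S(u)$ invariant under $\phi$ means $\phi(S(u))\subseteq S(u)$; $\phi_n$ is the $n$-th iterate of $\phi$; $\mathbb{N}-B$ is the complement of $B$ in $\mathbb{N}$. Dimensions and cardinalities take values in $\{0,1,2,\dots\}\cup\{\infty\}$, with all infinite values identified as $\infty$. *)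

theory Defs
  imports "HOL-Analysis.Infinite_Sum" "HOL-Library.Function_Algebras" "HOL-Library.Extended_Nat"
begin

typedef pnat = "{n::nat. 0 < n}"
  by blast

text \<open>The vector space operations on sequences are pointwise. Addition and zero come from
  Function_Algebras; complex scalar multiplication has to be supplied.\<close>

definition cscale :: "complex \<Rightarrow> (pnat \<Rightarrow> complex) \<Rightarrow> (pnat \<Rightarrow> complex)" where
  "cscale c f = (\<lambda>m. c * f m)"

global_interpretation cseq: vector_space cscale
  by unfold_locales (auto simp: cscale_def fun_eq_iff algebra_simps)

definition lp :: "real \<Rightarrow> (pnat \<Rightarrow> complex) set" where
  "lp p = {f. (\<lambda>m. norm (f m) powr p) summable_on UNIV}"

definition lp_norm :: "real \<Rightarrow> (pnat \<Rightarrow> complex) \<Rightarrow> real" where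
  "lp_norm p f = (\<Sum>\<^sub>\<infinity>m. norm (f m) powr p) powr (1 / p)"

text \<open>Since the exponent is a value and not a type, operators on the sequence space are
  represented by maps on all sequences, of which only the action on the carrier \<open>lp p\<close>
  matters.\<close>

definition bounded_linear_lp ::
    "real \<Rightarrow> ((pnat \<Rightarrow> complex) \<Rightarrow> (pnat \<Rightarrow> complex)) \<Rightarrow> bool" where
  "bounded_linear_lp p T \<longleftrightarrow>
     (\<forall>f\<in>lp p. T f \<in> lp p) \<and>
     (\<forall>f\<in>lp p. \<forall>g\<in>lp p. T (f + g) = T f + T g) \<and>
     (\<forall>c. \<forall>f\<in>lp p. T (cscale c f) = cscale c (T f)) \<and>
     (\<exists>K. \<forall>f\<in>lp p. lp_norm p (T f) \<le> K * lp_norm p f)"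

definition null_space_lp ::
    "real \<Rightarrow> ((pnat \<Rightarrow> complex) \<Rightarrow> (pnat \<Rightarrow> complex)) \<Rightarrow> (pnat \<Rightarrow> complex) set" where
  "null_space_lp p T = {f \<in> lp p. T f = 0}"

definition weighted_comp_op ::
    "(pnat \<Rightarrow> complex) \<Rightarrow> (pnat \<Rightarrow> pnat) \<Rightarrow> (pnat \<Rightarrow> complex) \<Rightarrow> (pnat \<Rightarrow> complex)" where
  "weighted_comp_op u \<phi> f = u * (f \<circ> \<phi>)"

definition supp :: "(pnat \<Rightarrow> complex) \<Rightarrow> pnat set" where
  "supp u = {m. u m \<noteq> 0}"

text \<open>The library's \<open>dim\<close> and \<open>card\<close> return 0 in the infinite case; the following variants
  return \<open>\<infinity>\<close> instead.\<close>

definition edim :: "(pnat \<Rightarrow> complex) set \<Rightarrow> enat" where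
  "edim V = (if \<exists>B. finite B \<and> B \<subseteq> V \<and> V \<subseteq> cseq.span B then enat (cseq.dim V) else \<infinity>)"

definition ecard :: "'a set \<Rightarrow> enat" where
  "ecard A = (if finite A then enat (card A) else \<infinity>)"

end

theory Submission imports Defs begin

text \<open>By invariance of the support of \<open>u\<close>, the weight \<open>u(m) u(\<phi>(m)) \<dots>\<close> by which
  \<open>(uC\<^sub>\<phi>)\<^sup>n\<close> multiplies \<open>f \<circ> \<phi>\<^sub>n\<close> is nonzero exactly on the support of \<open>u\<close>. Hence the kernel consists
  of the sequences that vanish on \<open>\<phi>\<^sub>n(S(u))\<close>, and the unit sequences at the remaining points
  are independent in it, and span it when there are finitely many of them.\<close>

definition unit_seq :: "pnat \<Rightarrow> pnat \<Rightarrow> complex" where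
  "unit_seq a = (\<lambda>m. if m = a then 1 else 0)"

lemma inj_unit_seq: "inj unit_seq"
  by (auto simp: inj_def unit_seq_def fun_eq_iff)

lemma finite_support_in_lp:
  assumes "finite A" and "\<And>m. m \<notin> A \<Longrightarrow> f m = 0"
  shows "f \<in> lp p"
proof -
  have "(\<lambda>m. norm (f m) powr p) summable_on A"
    using assms(1) by simp
  \<comment> \<open>\<open>0 powr p = 0\<close> for every real \<open>p\<close>, so the terms
    outside \<open>A\<close> vanish.\<close>
  then have "(\<lambda>m. norm (f m) powr p) summable_on UNIV"
    by (rule summable_on_cong_neutral[THEN iffD1, rotated -1]) (use assms(2) in auto)
  then show ?thesis
    by (simp add: lp_def)
qed

lemma independent_unit_seq: "cseq.independent (unit_seq ` A)"
proof
  assume "cseq.dependent (unit_seq ` A)"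
  then obtain a where a: "unit_seq a \<in> cseq.span (unit_seq ` A - {unit_seq a})"
    by (auto simp: cseq.dependent_def)
  \<comment> \<open>Evaluation at \<open>a\<close> kills the other unit sequences, hence their span,
    but takes the value 1 at \<open>unit_seq a\<close>.\<close>
  have "cseq.subspace {f. f a = 0}"
    by (auto simp: cseq.subspace_def cscale_def)
  then have "cseq.span (unit_seq ` A - {unit_seq a}) \<subseteq> {f. f a = 0}"
    by (intro cseq.span_minimal) (auto simp: unit_seq_def)
  with a show False
    by (auto simp: unit_seq_def)
qed

lemma finite_support_in_span_unit_seq:
  assumes "finite A" and "\<And>m. m \<notin> A \<Longrightarrow> f m = 0"
  shows "f \<in> cseq.span (unit_seq ` A)"
  using assms
proof (induction A arbitrary: f rule: finite_induct)
  case empty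
  then have "f = 0" by (simp add: fun_eq_iff)
  then show ?case by (simp only: cseq.span_zero)
next
  case (insert a A)
  \<comment> \<open>Removing the \<open>a\<close>-component makes \<open>?g\<close> vanish at
    \<open>a\<close> as well, so the induction hypothesis for \<open>A\<close> applies to
    it.\<close>
  let ?g = "f - cscale (f a) (unit_seq a)"
  have "?g \<in> cseq.span (unit_seq ` A)"
    using insert.prems by (intro insert.IH) (auto simp: cscale_def unit_seq_def)
  then have "?g \<in> cseq.span (unit_seq ` insert a A)"
    by (rule subsetD[OF cseq.span_mono, rotated]) auto
  moreover have "cscale (f a) (unit_seq a) \<in> cseq.span (unit_seq ` insert a A)"
    by (intro cseq.span_scale cseq.span_base) simp
  ultimately have "?g + cscale (f a) (unit_seq a) \<in> cseq.span (unit_seq ` insert a A)"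
    by (rule cseq.span_add)
  then show ?case by simp
qed

lemma edim_lp_supported:
  "edim {f \<in> lp p. \<forall>m. m \<notin> A \<longrightarrow> f m = 0} = ecard A" (is "edim ?V = _")
proof -
  have sub: "unit_seq ` A \<subseteq> ?V"
  proof (rule image_subsetI)
    fix a assume "a \<in> A"
    moreover have "unit_seq a \<in> lp p"
      by (rule finite_support_in_lp[of "{a}"]) (auto simp: unit_seq_def)
    ultimately show "unit_seq a \<in> ?V"
      by (auto simp: unit_seq_def)
  qed
  show ?thesis
  proof (cases "finite A")
    case True
    have span: "?V \<subseteq> cseq.span (unit_seq ` A)"
      using finite_support_in_span_unit_seq[OF True] by blast
    have "card (unit_seq ` A) = card A"
      by (simp add: card_image inj_on_subset[OF inj_unit_seq])
    then have "cseq.dim ?V = card A"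
      by (rule cseq.dim_unique[OF sub span independent_unit_seq])
    moreover have "\<exists>B. finite B \<and> B \<subseteq> ?V \<and> ?V \<subseteq> cseq.span B"
      using True sub span by blast
    ultimately show ?thesis
      unfolding edim_def ecard_def using True by simp
  next
    case False
    \<comment> \<open>An independent set inside the span of a finite set is finite, whereas
      \<open>unit_seq\<close> embeds the infinite set \<open>A\<close> into
      \<open>?V\<close>.\<close>
    have "\<not> ?V \<subseteq> cseq.span B" if "finite B" for B
    proof
      assume "?V \<subseteq> cseq.span B"
      with sub have "finite (unit_seq ` A)"
        using cseq.independent_span_bound[OF that independent_unit_seq[of A]] by blast
      with False show False
        by (simp add: finite_image_iff inj_on_subset[OF inj_unit_seq])
    qed
    then show ?thesis
      unfolding edim_def ecard_def using False by auto
  qed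
qed

text \<open>The orbit of a point of \<open>supp u\<close> stays in \<open>supp u\<close>, so no
  later factor of the weight vanishes. The bound on \<open>n\<close> provides the first factor
  \<open>u m\<close>; the zeroth power carries no weight.\<close>

lemma weighted_comp_op_power_eq_0_iff:
  assumes "\<phi> ` supp u \<subseteq> supp u" and "1 \<le> n"
  shows "(weighted_comp_op u \<phi> ^^ n) f m = 0 \<longleftrightarrow> m \<notin> supp u \<or> f ((\<phi> ^^ n) m) = 0"
  using assms(2)
proof (induction n arbitrary: m rule: dec_induct)
  case base
  then show ?case by (simp add: weighted_comp_op_def supp_def)
next
  case (step n)
  \<comment> \<open>Splitting off the outermost application moves the point to
    \<open>\<phi> m\<close>, which is why the induction keeps \<open>m\<close> arbitrary.\<close>
  have "(weighted_comp_op u \<phi> ^^ Suc n) f m = u m * (weighted_comp_op u \<phi> ^^ n) f (\<phi> m)"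
    by (simp add: weighted_comp_op_def)
  moreover have "m \<in> supp u \<Longrightarrow> \<phi> m \<in> supp u"
    using assms(1) by blast
  ultimately show ?case
    using step.IH by (auto simp: supp_def funpow_swap1)
qed

theorem theorem2p3:
  fixes p :: real and u :: "pnat \<Rightarrow> complex" and \<phi> :: "pnat \<Rightarrow> pnat" and n :: nat
  assumes "1 \<le> p"
    and "bounded_linear_lp p (weighted_comp_op u \<phi>)"
    and "\<phi> ` supp u \<subseteq> supp u"
    and "1 \<le> n"
  shows "edim (null_space_lp p (weighted_comp_op u \<phi> ^^ n)) = ecard (UNIV - (\<phi> ^^ n) ` supp u)"
proof -
  have "null_space_lp p (weighted_comp_op u \<phi> ^^ n) =
      {f \<in> lp p. \<forall>m. m \<notin> UNIV - (\<phi> ^^ n) ` supp u \<longrightarrow> f m = 0}"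
    using weighted_comp_op_power_eq_0_iff[OF assms(3,4)]
    by (auto simp: null_space_lp_def fun_eq_iff)
  then show ?thesis
    by (simp only: edim_lp_supported)
qed

end
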